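(* Let $\mathcal{B}$ be a connected building set on a finite ground set $E$ which is closed under intersection. Then the normal fan of the removahedron $\mathrm{Remo}(\mathcal{B})$ is the $\mathcal{B}$-nested fan $\mathcal{F}(\mathcal{B})$. In particular, $\mathrm{Remo}(\mathcal{B})$ is a simple polytope.
   Context: Let $E$ be a finite set and $(e_s)_{s\in E}$ the standard basis of $\mathbb{R}^E$; for $R\subseteq E$ put $\mathbb{1}_R=\sum_{r\in R}e_r$. A building set on $E$ is a collection $\mathcal{B}$ of non-empty subsets of $E$ such that (B1) if $B,B'\in\mathcal{B}$ and $B\cap B'\neq\varnothing$ then $B\cup B'\in\mathcal{B}$, and (B2) $\{s\}\in\mathcal{B}$ for all $s\in E$. It is connected if $E\in\mathcal{B}$ (so $E$ is the unique maximal element). It is closed under intersection if $B,B'\in\mathcal{B}$ implies $B\cap B'\in\mathcal{B}\cup\{\varnothing\}$. A $\mathcal{B}$-nested set is a subset $\mathcal{N}\subseteq\mathcal{B}\setminus\{E\}$ such that (N1) for any $N,N'\in\mathcal{N}$, either $N\subseteq N'$, $N'\subseteq N$ or $N\cap N'=\varnothing$, and (N2) for any $k\ge 2$ pairwise disjoint $N_1,\dots,N_k\in\mathcal{N}$, the union $N_1\cup\dots\cup N_k$ is not in $\mathcal{B}$. Let $V=\{x\in\mathbb{R}^E:\sum_s x_s=0\}$ and let $\bar{\mathbb{1}}_R$ denote the orthogonal projection of $\mathbb{1}_R$ onto $V$. The $\mathcal{B}$-nested fan $\mathcal{F}(\mathcal{B})$ is the collection of cones $\mathrm{cone}\{\bar{\mathbb{1}}_N: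 N\in\mathcal{N}\}\subseteq V$ over all $\mathcal{B}$-nested sets $\mathcal{N}$ (it is a complete simplicial fan in $V$). The removahedron of $\mathcal{B}$ is $\mathrm{Remo}(\mathcal{B})=\{x\in\mathbb{R}^E:\sum_{s\in E}x_s=\binom{|E|+1}{2},\ \sum_{s\in B}x_s\ge\binom{|B|+1}{2}\text{ for all }B\in\mathcal{B}\}$. For a polytope $P$ contained in a translate of $V$, the normal cone of a non-empty face $F$ is $\{c\in V:\langle c,x\rangle\le\langle c,y\rangle\text{ for all }x\in F,\,y\in P\}$, and the normal fan of $P$ is the collection of the normal cones of its non-empty faces. *)

theory Defs
  imports "HOL-Analysis.Analysis"
begin

text \<open>
  The finite ground set \<open>E\<close> is the universe of a type \<open>'e::finite\<close>, so that \<open>R^E\<close> is \<open>real^'e\<close> and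
  \<open>E\<close> itself is \<open>UNIV\<close>. Types are non-empty, which loses nothing here: a connected building
  set has \<open>E\<close> as a member, and its members are non-empty.
\<close>

section \<open>Building sets and nested sets\<close>

definition building_set :: "'e::finite set set \<Rightarrow> bool" where
  "building_set \<B> \<longleftrightarrow>
     (\<forall>B\<in>\<B>. B \<noteq> {}) \<and>
     (\<forall>B\<in>\<B>. \<forall>B'\<in>\<B>. B \<inter> B' \<noteq> {} \<longrightarrow> B \<union> B' \<in> \<B>) \<and>
     (\<forall>s. {s} \<in> \<B>)"

definition connected_building_set :: "'e::finite set set \<Rightarrow> bool" where
  "connected_building_set \<B> \<longleftrightarrow> building_set \<B> \<and> UNIV \<in> \<B>"

definition closed_under_intersection :: "'e set set \<Rightarrow> bool" where
  "closed_under_intersection \<B> \<longleftrightarrow> (\<forall>B\<in>\<B>. \<forall>B'\<in>\<B>. B \<inter> B' \<in> \<B> \<union> {{}})"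

text \<open>In the last condition the family \<open>N\<^sub>1, \<dots>, N\<^sub>k\<close> is given as a set \<open>S\<close>: pairwise disjoint
  non-empty sets are distinct.\<close>

definition nested_set :: "'e::finite set set \<Rightarrow> 'e set set \<Rightarrow> bool" where
  "nested_set \<B> \<N> \<longleftrightarrow>
     \<N> \<subseteq> \<B> - {UNIV} \<and>
     (\<forall>N\<in>\<N>. \<forall>N'\<in>\<N>. N \<subseteq> N' \<or> N' \<subseteq> N \<or> N \<inter> N' = {}) \<and>
     (\<forall>S\<subseteq>\<N>. card S \<ge> 2 \<and> pairwise disjnt S \<longrightarrow> \<Union>S \<notin> \<B>)"

section \<open>The nested fan\<close>

definition indicator_vec :: "'e::finite set \<Rightarrow> real^'e" where
  "indicator_vec R = (\<Sum>r\<in>R. axis r 1)"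

definition sum_zero_space :: "(real^'e::finite) set" where
  "sum_zero_space = {x. (\<Sum>s\<in>UNIV. x $ s) = 0}"

definition orthogonal_proj :: "'a::euclidean_space set \<Rightarrow> 'a \<Rightarrow> 'a" where
  "orthogonal_proj S x = (THE y. y \<in> S \<and> (\<forall>z\<in>S. orthogonal (x - y) z))"

lemma orthogonal_proj_eqI:
  assumes "subspace S" "y \<in> S" "\<And>z. z \<in> S \<Longrightarrow> orthogonal (x - y) z"
  shows "orthogonal_proj S x = y"
  unfolding orthogonal_proj_def
proof (rule the_equality)
  show "y \<in> S \<and> (\<forall>z\<in>S. orthogonal (x - y) z)"
    using assms by blast
next
  fix y' assume y': "y' \<in> S \<and> (\<forall>z\<in>S. orthogonal (x - y') z)"
  have "y' - y \<in> S"
    using y' assms subspace_diff by blast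
  then have "(x - y) \<bullet> (y' - y) = 0" "(x - y') \<bullet> (y' - y) = 0"
    using y' assms(3) by (auto simp: orthogonal_def)
  then have "(y' - y) \<bullet> (y' - y) = 0"
    by (simp add: inner_diff_left)
  then show "y' = y"
    by simp
qed

text \<open>\<open>convex_cone hull\<close> is the set of all non-negative linear combinations; it is \<open>{0}\<close> for the empty
  set of generators, whereas \<open>cone hull {}\<close> is empty.\<close>

definition nested_fan :: "'e::finite set set \<Rightarrow> (real^'e) set set" where
  "nested_fan \<B> =
     {convex_cone hull ((\<lambda>N. orthogonal_proj sum_zero_space (indicator_vec N)) ` \<N>) | \<N>.
        nested_set \<B> \<N>}"

section \<open>The removahedron and its normal fan\<close>

definition removahedron :: "'e::finite set set \<Rightarrow> (real^'e) set" where
  "removahedron \<B> =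
     {x. (\<Sum>s\<in>UNIV. x $ s) = real ((CARD('e) + 1) choose 2) \<and>
         (\<forall>B\<in>\<B>. (\<Sum>s\<in>B. x $ s) \<ge> real ((card B + 1) choose 2))}"

definition normal_cone :: "(real^'e::finite) set \<Rightarrow> (real^'e) set \<Rightarrow> (real^'e) set" where
  "normal_cone P F = {c \<in> sum_zero_space. \<forall>x\<in>F. \<forall>y\<in>P. c \<bullet> x \<le> c \<bullet> y}"

definition normal_fan :: "(real^'e::finite) set \<Rightarrow> (real^'e) set set" where
  "normal_fan P = {normal_cone P F | F. F face_of P \<and> F \<noteq> {}}"

text \<open>A polytope of dimension \<open>d\<close> is simple if each of its vertices lies on exactly \<open>d\<close> facets.\<close>

definition simple_polytope :: "'a::euclidean_space set \<Rightarrow> bool" where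
  "simple_polytope P \<longleftrightarrow>
     polytope P \<and>
     (\<forall>v. v extreme_point_of P \<longrightarrow> int (card {F. F facet_of P \<and> v \<in> F}) = aff_dim P)"

end

theory Submission
  imports Defs
begin

text \<open>
  Call \<open>B \<in> \<B> - {UNIV}\<close> tight at a point \<open>x\<close> of the removahedron if its inequality holds with equality
  at \<open>x\<close>. Since \<open>R \<mapsto> (|R| + 1 choose 2)\<close> is strictly supermodular on non-nested pairs and \<open>\<B>\<close> is
  closed under intersection, uncrossing shows that the tight sets at any point form a nested set.
  By Farkas' lemma the normal cone of a face is spanned by the tight sets at a point in its relative
  interior, so it is the cone of a nested set. Conversely, minimise over the removahedron a functional
  in the relative interior of the cone of a nested set \<open>\<N>\<close>. At a minimiser the functional lies in
  the cone of the tight sets; as a nested set can be read off from the superlevel sets of such a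
  functional, \<open>\<N>\<close> is contained in the tight sets, and since the indicator vectors of a nested set
  together with \<open>UNIV\<close> are linearly independent the remaining tight sets can be relaxed.
  Linear independence also makes the number of tight sets at a vertex equal to the dimension.
\<close>

section \<open>Indicator vectors, the projection onto \<open>sum_zero_space\<close>, and finitely
  generated cones\<close>

lemma indicator_vec_nth: "indicator_vec R $ s = (if s \<in> R then 1 else 0)"
  by (simp add: indicator_vec_def axis_def)

lemma inner_indicator_vec: "indicator_vec R \<bullet> x = (\<Sum>s\<in>R. x $ s)"
  by (simp add: indicator_vec_def inner_sum_left inner_axis')

lemma inner_indicator_vec': "x \<bullet> indicator_vec R = (\<Sum>s\<in>R. x $ s)"
  by (metis inner_commute inner_indicator_vec)

lemma inj_indicator_vec: "inj indicator_vec"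
proof
  fix R R' :: "'a set"
  assume "indicator_vec R = indicator_vec R'"
  then have "indicator_vec R $ s = indicator_vec R' $ s" for s
    by simp
  then have "s \<in> R \<longleftrightarrow> s \<in> R'" for s
    by (metis indicator_vec_nth zero_neq_one)
  then show "R = R'"
    by blast
qed

lemma subspace_sum_zero_space: "subspace (sum_zero_space :: (real^'e::finite) set)"
  by (simp add: subspace_def sum_zero_space_def sum.distrib flip: sum_distrib_left)

lemma sum_zero_space_iff_inner: "x \<in> sum_zero_space \<longleftrightarrow> indicator_vec UNIV \<bullet> x = 0"
  by (simp add: sum_zero_space_def inner_indicator_vec)

text \<open>\<open>sum_zero_space\<close> is the hyperplane orthogonal to the all-ones vector, so
  projecting subtracts the mean from every coordinate.\<close>

lemma orthogonal_proj_sum_zero_space: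
  fixes x :: "real^'e::finite"
  shows "orthogonal_proj sum_zero_space x =
    x - ((\<Sum>s\<in>UNIV. x $ s) / CARD('e)) *\<^sub>R indicator_vec UNIV"
  by (intro orthogonal_proj_eqI subspace_sum_zero_space)
    (auto simp: sum_zero_space_iff_inner orthogonal_def inner_diff_right inner_indicator_vec
      indicator_vec_nth)

lemma orthogonal_proj_in_sum_zero_space:
  fixes x :: "real^'e::finite"
  shows "orthogonal_proj sum_zero_space x \<in> sum_zero_space"
  by (auto simp: orthogonal_proj_sum_zero_space sum_zero_space_iff_inner inner_diff_right
      inner_indicator_vec indicator_vec_nth)

text \<open>Self-adjointness: against vectors of \<open>sum_zero_space\<close>, a projected
  indicator acts like the plain one, that is, as a coordinate sum.\<close>

lemma inner_orthogonal_proj_sum_zero_space: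
  fixes x y :: "real^'e::finite"
  shows "orthogonal_proj sum_zero_space x \<bullet> y = x \<bullet> orthogonal_proj sum_zero_space y"
  by (simp add: orthogonal_proj_sum_zero_space inner_diff_left inner_diff_right
      inner_indicator_vec inner_indicator_vec')

lemma orthogonal_proj_id_sum_zero_space:
  fixes x :: "real^'e::finite"
  shows "x \<in> sum_zero_space \<Longrightarrow> orthogonal_proj sum_zero_space x = x"
  unfolding orthogonal_proj_sum_zero_space by (simp add: sum_zero_space_def)

text \<open>The non-negative combinations form a convex cone containing the generators, so they
  contain the hull. Coefficients are indexed by \<open>S\<close>, so \<open>g\<close> may identify
  some of its members.\<close>

lemma convex_cone_hull_image_sumE:
  assumes "finite S" "c \<in> convex_cone hull (g ` S)"
  obtains k :: "'b \<Rightarrow> real" where "\<And>B. B \<in> S \<Longrightarrow> k B \<ge> 0" "c = (\<Sum>B\<in>S. k B *\<^sub>R g B)"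
proof -
  let ?C = "{y. \<exists>k. (\<forall>B\<in>S. (k B :: real) \<ge> 0) \<and> y = (\<Sum>B\<in>S. k B *\<^sub>R g B)}"
  have "convex_cone ?C"
    unfolding convex_cone_iff
  proof (intro conjI ballI allI impI)
    show "0 \<in> ?C"
      by (auto intro!: exI[of _ "\<lambda>_. 0"])
  next
    fix x y assume "x \<in> ?C" "y \<in> ?C"
    then obtain k l where "\<forall>B\<in>S. (k B :: real) \<ge> 0" "x = (\<Sum>B\<in>S. k B *\<^sub>R g B)"
      "\<forall>B\<in>S. (l B :: real) \<ge> 0" "y = (\<Sum>B\<in>S. l B *\<^sub>R g B)"
      by blast
    then show "x + y \<in> ?C"
      by (auto intro!: exI[of _ "\<lambda>B. k B + l B"] simp: scaleR_add_left sum.distrib)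
  next
    fix x and a :: real assume "x \<in> ?C" "a \<ge> 0"
    then obtain k where "\<forall>B\<in>S. (k B :: real) \<ge> 0" "x = (\<Sum>B\<in>S. k B *\<^sub>R g B)"
      by blast
    with \<open>a \<ge> 0\<close> show "a *\<^sub>R x \<in> ?C"
      by (auto intro!: exI[of _ "\<lambda>B. a * k B"] simp: scaleR_sum_right)
  qed
  moreover have "g ` S \<subseteq> ?C"
  proof
    fix y assume "y \<in> g ` S"
    then obtain B where "B \<in> S" "y = g B"
      by blast
    moreover have "(\<Sum>A\<in>S. (if A = B then 1 else 0) *\<^sub>R g A) = (\<Sum>A\<in>S. if A = B then g A else 0)"
      by (intro sum.cong) auto
    ultimately show "y \<in> ?C"
      using \<open>finite S\<close> by (auto intro!: exI[of _ "\<lambda>A. if A = B then 1 else 0"])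
  qed
  ultimately have "convex_cone hull (g ` S) \<subseteq> ?C"
    by (simp add: hull_minimal)
  then show thesis
    using assms(2) that by blast
qed

section \<open>Supermodularity\<close>

lemma real_Suc_choose_two: "real (Suc n choose 2) = real n * (real n + 1) / 2"
  by (simp add: choose_two real_of_nat_div algebra_simps)

lemma real_Suc_add_choose_two:
  "real (Suc (m + n) choose 2) = real (Suc m choose 2) + real (Suc n choose 2) + real m * real n"
  by (simp add: real_Suc_choose_two field_simps del: of_nat_Suc)

text \<open>The two sides differ by exactly \<open>p * q\<close>, which is positive because neither
  difference set is empty.\<close>

lemma choose_two_supermodular:
  fixes A B :: "'a::finite set"
  assumes "\<not> A \<subseteq> B" "\<not> B \<subseteq> A"
  shows "real ((card A + 1) choose 2) + real ((card B + 1) choose 2)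
    < real ((card (A \<union> B) + 1) choose 2) + real ((card (A \<inter> B) + 1) choose 2)"
proof -
  define p q i where "p = card (A - B)" and "q = card (B - A)" and "i = card (A \<inter> B)"
  have pos: "0 < real p * real q"
    using assms by (simp add: p_def q_def card_gt_0_iff)
  have "card A = p + i" "card B = q + i"
    unfolding p_def q_def i_def
    by (subst card_Un_disjoint[symmetric]; auto intro!: arg_cong[where f = card])+
  moreover have "card (A \<union> B) = p + q + i"
    using \<open>card A = p + i\<close> \<open>card B = q + i\<close> card_Un_Int[of A B] by (simp add: i_def)
  ultimately have "real (card A) = real p + real i" "real (card B) = real q + real i"
    "real (card (A \<union> B)) = real p + real q + real i"
    by simp_all
  then show ?thesis
    using pos by (simp add: real_Suc_choose_two i_def[symmetric] field_simps del: of_nat_Suc)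
qed

text \<open>Merging two disjoint blocks raises the value by the product of their sizes.\<close>

lemma choose_two_sum_disjoint:
  fixes S :: "'a::finite set set"
  assumes "pairwise disjnt S"
  shows "(\<Sum>N\<in>S. real ((card N + 1) choose 2)) \<le> real ((card (\<Union>S) + 1) choose 2)"
  using finite[of S] assms
proof (induction S rule: finite_induct)
  case (insert N S)
  have "card (N \<union> \<Union>S) = card N + card (\<Union>S)"
    using insert.prems insert.hyps
    by (intro card_Un_disjoint) (auto simp: pairwise_insert disjnt_def)
  moreover have "(\<Sum>N\<in>S. real ((card N + 1) choose 2)) \<le> real ((card (\<Union>S) + 1) choose 2)"
    using insert by (simp add: pairwise_insert)
  ultimately show ?case
    using insert.hyps by (simp add: real_Suc_add_choose_two add_increasing2)
qed (simp add: real_Suc_choose_two)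

text \<open>Merging one member with the non-empty union of the others already gains a positive
  product.\<close>

lemma choose_two_sum_disjoint_strict:
  fixes S :: "'a::finite set set"
  assumes "pairwise disjnt S" "card S \<ge> 2" "{} \<notin> S"
  shows "(\<Sum>N\<in>S. real ((card N + 1) choose 2)) < real ((card (\<Union>S) + 1) choose 2)"
proof -
  obtain N where "N \<in> S"
    using assms(2) by fastforce
  define S' where "S' = S - {N}"
  have S: "S = insert N S'" "N \<notin> S'"
    using \<open>N \<in> S\<close> by (auto simp: S'_def)
  have "S' \<noteq> {}"
    using assms(2) S by auto
  have "N \<noteq> {}" "\<Union>S' \<noteq> {}"
    using assms(3) S \<open>S' \<noteq> {}\<close> by auto
  then have "0 < real (card N) * real (card (\<Union>S'))"
    by (simp add: card_gt_0_iff)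
  moreover have "card (\<Union>S) = card N + card (\<Union>S')"
    using assms(1) S card_Un_disjoint[of N "\<Union>S'"] by (auto simp: pairwise_insert disjnt_def)
  moreover have "(\<Sum>N\<in>S'. real ((card N + 1) choose 2)) \<le> real ((card (\<Union>S') + 1) choose 2)"
    using assms(1) S by (intro choose_two_sum_disjoint) (simp add: pairwise_insert)
  ultimately show ?thesis
    using S by (simp add: real_Suc_add_choose_two add_increasing2)
qed

section \<open>Nested sets\<close>

lemma nested_set_subset: "nested_set \<B> \<N> \<Longrightarrow> \<M> \<subseteq> \<N> \<Longrightarrow> nested_set \<B> \<M>"
  unfolding nested_set_def by (meson subset_iff subset_trans)

lemma building_set_Un:
  "building_set \<B> \<Longrightarrow> B \<in> \<B> \<Longrightarrow> B' \<in> \<B> \<Longrightarrow> B \<inter> B' \<noteq> {} \<Longrightarrow> B \<union> B' \<in> \<B>"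
  by (simp add: building_set_def)

text \<open>The members of \<open>S\<close> are absorbed one at a time: each meets \<open>B\<close>,
  hence the union built so far, and (B1) applies.\<close>

lemma building_set_Un_Union:
  fixes \<B> :: "'e::finite set set"
  assumes "building_set \<B>" "B \<in> \<B>" "S \<subseteq> \<B>" "\<And>N. N \<in> S \<Longrightarrow> N \<inter> B \<noteq> {}"
  shows "B \<union> \<Union>S \<in> \<B>"
  using finite[of S] assms(3,4)
proof (induction S rule: finite_induct)
  case (insert N S)
  then have "B \<union> \<Union>S \<in> \<B>" "N \<in> \<B>" "(B \<union> \<Union>S) \<inter> N \<noteq> {}"
    by auto
  then have "(B \<union> \<Union>S) \<union> N \<in> \<B>"
    by (rule building_set_Un[OF assms(1)])
  then show ?case
    by (simp add: Un_ac)
qed (use assms in simp)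

text \<open>\<open>Q\<close> is a minimal member of \<open>insert UNIV \<N>\<close> above
  \<open>B\<close>. If no \<open>e\<close> worked, \<open>B\<close> would be covered by members of
  \<open>\<N>\<close> that do not contain \<open>Q\<close>. The maximal ones meeting
  \<open>B\<close> are disjoint and have their union in \<open>\<B>\<close>, so by (N2) there is
  only one. It contains \<open>B\<close> and lies strictly inside \<open>Q\<close>, against
  minimality.\<close>

lemma nested_set_representative:
  fixes \<B> :: "'e::finite set set"
  assumes \<B>: "building_set \<B>" and \<N>: "nested_set \<B> \<N>" and B: "B \<in> \<B>"
  obtains Q e where "Q \<in> insert UNIV \<N>" "B \<subseteq> Q" "e \<in> B" "\<forall>N\<in>\<N>. e \<in> N \<longrightarrow> Q \<subseteq> N"
proof -
  have lam: "N \<subseteq> N' \<or> N' \<subseteq> N \<or> N \<inter> N' = {}" if "N \<in> \<N>" "N' \<in> \<N>" for N N'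
    using \<N> that by (auto simp: nested_set_def)
  let ?A = "{Q \<in> insert UNIV \<N>. B \<subseteq> Q}"
  have "\<exists>Q\<in>?A. \<forall>R\<in>?A. R \<subseteq> Q \<longrightarrow> Q = R"
    by (rule finite_has_minimal) auto
  then obtain Q where QA: "Q \<in> ?A" and min: "\<forall>R\<in>?A. R \<subseteq> Q \<longrightarrow> Q = R"
    by (rule bexE)
  then have Q: "Q \<in> insert UNIV \<N>" "B \<subseteq> Q"
    by blast+
  have "\<exists>e\<in>B. \<forall>N\<in>\<N>. e \<in> N \<longrightarrow> Q \<subseteq> N"
  proof (rule ccontr)
    assume contra: "\<not> ?thesis"
    define D where "D = {N\<in>\<N>. N \<inter> B \<noteq> {} \<and> \<not> Q \<subseteq> N}"
    define S where "S = {N\<in>D. \<forall>N'\<in>D. N \<subseteq> N' \<longrightarrow> N = N'}"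
    have "B \<subseteq> \<Union>S"
    proof
      fix e assume "e \<in> B"
      then obtain N where "N \<in> \<N>" "e \<in> N" "\<not> Q \<subseteq> N"
        using contra by blast
      then have "N \<in> D"
        using \<open>e \<in> B\<close> by (auto simp: D_def)
      moreover obtain N' where "N' \<in> D" "N \<subseteq> N'" "\<forall>N''\<in>D. N' \<subseteq> N'' \<longrightarrow> N' = N''"
        using finite_has_maximal2[of D N] \<open>N \<in> D\<close> by auto
      ultimately show "e \<in> \<Union>S"
        using \<open>e \<in> N\<close> by (auto simp: S_def)
    qed
    \<comment> \<open>Every member of \<open>S\<close> meets \<open>B\<close>, and \<open>S\<close>
      covers \<open>B\<close>, so this union is \<open>\<Union>S\<close> itself.\<close>
    moreover have "B \<union> \<Union>S \<in> \<B>"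
      using \<N> by (intro building_set_Un_Union \<B> B) (auto simp: S_def D_def nested_set_def)
    ultimately have "\<Union>S \<in> \<B>"
      by (simp add: sup_absorb2)
    moreover have "pairwise disjnt S"
    proof (rule pairwiseI)
      fix N N' assume *: "N \<in> S" "N' \<in> S" "N \<noteq> N'"
      then have "N \<in> \<N>" "N' \<in> \<N>" "\<not> N \<subseteq> N'" "\<not> N' \<subseteq> N"
        by (auto simp: S_def D_def)
      then show "disjnt N N'"
        using lam[of N N'] by (simp add: disjnt_def)
    qed
    moreover have "S \<subseteq> \<N>"
      by (auto simp: S_def D_def)
    ultimately have "\<not> card S \<ge> 2"
      using \<N> unfolding nested_set_def by blast
    moreover have "B \<noteq> {}"
      using \<B> B by (auto simp: building_set_def)
    then have "S \<noteq> {}"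
      using \<open>B \<subseteq> \<Union>S\<close> by auto
    then have "card S \<noteq> 0"
      by simp
    ultimately have "card S = 1"
      by linarith
    then obtain N where N1: "S = {N}"
      using card_1_singletonE by blast
    then have "N \<in> D"
      by (auto simp: S_def)
    then have N: "N \<in> \<N>" "\<not> Q \<subseteq> N" "B \<subseteq> N"
      using \<open>B \<subseteq> \<Union>S\<close> unfolding N1 by (auto simp: D_def)
    \<comment> \<open>Both sets contain the non-empty \<open>B\<close>, so they cannot be disjoint
      and must be comparable.\<close>
    then have "N \<subseteq> Q"
      using Q lam[of N Q] \<open>B \<noteq> {}\<close> by auto
    then show False
      using min N by blast
  qed
  then obtain e where "e \<in> B" "\<forall>N\<in>\<N>. e \<in> N \<longrightarrow> Q \<subseteq> N"
    by (rule bexE)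
  then show thesis
    by (rule that[OF Q])
qed

text \<open>A point of \<open>Q\<close> outside all members strictly below \<open>Q\<close>: the
  previous lemma with \<open>B = Q\<close>.\<close>

lemma nested_set_representative_self:
  fixes \<B> :: "'e::finite set set"
  assumes "connected_building_set \<B>" "nested_set \<B> \<N>" "Q \<in> insert UNIV \<N>"
  obtains e where "e \<in> Q" "\<forall>N\<in>insert UNIV \<N>. e \<in> N \<longrightarrow> Q \<subseteq> N"
proof -
  have "building_set \<B>" "Q \<in> \<B>"
    using assms by (auto simp: connected_building_set_def nested_set_def)
  then obtain Q' e where Q': "Q' \<in> insert UNIV \<N>" "Q \<subseteq> Q'" "e \<in> Q" "\<forall>N\<in>\<N>. e \<in> N \<longrightarrow> Q' \<subseteq> N"
    by (rule nested_set_representative[OF _ assms(2)])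
  show thesis
    by (rule that[of e]) (use Q' in auto)
qed

text \<open>The coefficient of an inclusion-maximal set in the support of a vanishing combination is read
  off at a representative of that set.\<close>

lemma nested_set_independent:
  fixes \<B> :: "'e::finite set set"
  assumes \<B>: "connected_building_set \<B>" and \<N>: "nested_set \<B> \<N>"
  shows "independent (indicator_vec ` insert UNIV \<N>)"
proof (rule independent_if_scalars_zero)
  fix u :: "real^'e \<Rightarrow> real" and v
  assume "(\<Sum>x\<in>indicator_vec ` insert UNIV \<N>. u x *\<^sub>R x) = 0"
    and v: "v \<in> indicator_vec ` insert UNIV \<N>"
  then have 0: "(\<Sum>N\<in>insert UNIV \<N>. u (indicator_vec N) *\<^sub>R indicator_vec N) = 0"
    using sum.reindex[OF inj_on_subset[OF inj_indicator_vec subset_UNIV],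
        of "\<lambda>x. u x *\<^sub>R x" "insert UNIV \<N>"] by (simp only: o_def)
  show "u v = 0"
  proof (rule ccontr)
    assume "u v \<noteq> 0"
    let ?A = "{N\<in>insert UNIV \<N>. u (indicator_vec N) \<noteq> 0}"
    obtain A where "A \<in> ?A"
      using v \<open>u v \<noteq> 0\<close> by blast
    then obtain Q where Q: "Q \<in> ?A" and max: "\<forall>N\<in>?A. Q \<subseteq> N \<longrightarrow> Q = N"
      using finite_has_maximal2[of ?A A] by (metis (no_types, lifting) finite)
    have QN: "Q \<in> insert UNIV \<N>"
      using Q by blast
    obtain e where e: "e \<in> Q" "\<forall>N\<in>insert UNIV \<N>. e \<in> N \<longrightarrow> Q \<subseteq> N"
      by (rule nested_set_representative_self[OF \<B> \<N> QN])
    have "0 = (\<Sum>N\<in>insert UNIV \<N>. u (indicator_vec N) *\<^sub>R indicator_vec N) $ e"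
      by (simp only: 0 zero_index)
    \<comment> \<open>Members not containing \<open>Q\<close> miss \<open>e\<close>; those strictly
      containing \<open>Q\<close> have coefficient 0 by maximality.\<close>
    also have "\<dots> = (\<Sum>N\<in>insert UNIV \<N>. if N = Q then u (indicator_vec N) else 0)"
      unfolding sum_component using e max by (intro sum.cong refl) (auto simp: indicator_vec_nth)
    also have "\<dots> = u (indicator_vec Q)"
      using Q by simp
    finally show False
      using Q by simp
  qed
qed auto

text \<open>By linear independence, arbitrary values on the indicator vectors extend to a linear
  functional. This supplies directions that loosen chosen tight sets and keep the others.\<close>

lemma nested_set_interpolation:
  fixes \<B> :: "'e::finite set set" and h :: "'e set \<Rightarrow> real"
  assumes "connected_building_set \<B>" "nested_set \<B> \<N>"
  obtains d :: "real^'e" where "\<forall>N\<in>insert UNIV \<N>. (\<Sum>s\<in>N. d $ s) = h N"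
proof -
  obtain g :: "real^'e \<Rightarrow> real" where g: "linear g"
    "\<forall>x\<in>indicator_vec ` insert UNIV \<N>. g x = h (the_inv indicator_vec x)"
    using linear_independent_extend[OF nested_set_independent[OF assms],
        of "\<lambda>x. h (the_inv indicator_vec x)"] by (elim exE conjE)
  \<comment> \<open>\<open>adjoint g 1\<close> is the vector that represents the functional
    \<open>g\<close> through the inner product.\<close>
  have "(\<Sum>s\<in>N. adjoint g 1 $ s) = h N" if "N \<in> insert UNIV \<N>" for N
  proof -
    have "(\<Sum>s\<in>N. adjoint g 1 $ s) = g (indicator_vec N)"
      using adjoint_works[OF g(1), of "indicator_vec N" 1] by (simp add: inner_indicator_vec)
    also have "\<dots> = h N"
      using g(2) that by (auto simp: the_inv_f_f[OF inj_indicator_vec])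
    finally show ?thesis .
  qed
  then show thesis
    by (intro that ballI)
qed

text \<open>The members of a nested set are recovered from any point in the relative interior of its cone:
  they are the members of \<open>\<B>\<close> that are inclusion-maximal in a superlevel set.\<close>

lemma nested_set_eq_superlevel:
  fixes \<B> :: "'e::finite set set" and k :: "'e set \<Rightarrow> real"
  assumes \<B>: "connected_building_set \<B>" and \<N>: "nested_set \<B> \<N>"
    and pos: "\<And>N. N \<in> \<N> \<Longrightarrow> k N > 0"
    and c: "\<And>s. c s = a + (\<Sum>N\<in>\<N>. if s \<in> N then k N else 0)"
  shows "\<N> = {B \<in> \<B> - {UNIV}. \<forall>K\<in>\<B>. B \<subseteq> K \<and> (\<forall>e\<in>K. \<exists>b\<in>B. c b \<le> c e) \<longrightarrow> K = B}"
    (is "_ = ?R")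
\<comment> \<open>The condition on \<open>K\<close> says that \<open>K\<close> lies in the
  superlevel set of \<open>c\<close> at its minimum over \<open>B\<close>. The constant
  \<open>a\<close> does not affect such comparisons.\<close>
proof (intro subset_antisym subsetI)
  have bs: "building_set \<B>"
    using \<B> by (simp add: connected_building_set_def)
  have le: "c e \<le> c s" if "\<forall>N\<in>\<N>. e \<in> N \<longrightarrow> Q \<subseteq> N" "s \<in> Q" for e s Q
    unfolding c using that pos by (intro add_left_mono sum_mono) (auto intro: less_imp_le)
  \<comment> \<open>Here \<open>N\<close> contains \<open>s\<close> but not \<open>e\<close>, since
    otherwise \<open>Q \<subseteq> N \<subset> Q\<close>; its positive weight makes the comparison
    strict.\<close>
  have less: "c e < c s"
    if "\<forall>N\<in>\<N>. e \<in> N \<longrightarrow> Q \<subseteq> N" "N \<in> \<N>" "N \<subset> Q" "s \<in> N" for e s Q N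
    unfolding c
  proof (intro add_strict_left_mono sum_strict_mono_ex1)
    have "e \<notin> N"
      using that by blast
    then show "\<exists>N\<in>\<N>. (if e \<in> N then k N else 0) < (if s \<in> N then k N else 0)"
      using that pos by auto
    show "\<forall>M\<in>\<N>. (if e \<in> M then k M else 0) \<le> (if s \<in> M then k M else 0)"
      using that pos by (auto intro: less_imp_le)
  qed simp
  {
    fix N assume N: "N \<in> \<N>"
    have "K = N" if K: "K \<in> \<B>" "N \<subseteq> K" "\<forall>e\<in>K. \<exists>b\<in>N. c b \<le> c e" for K
    proof -
      obtain Q e where Q: "Q \<in> insert UNIV \<N>" "K \<subseteq> Q" "e \<in> K"
        "\<forall>N\<in>\<N>. e \<in> N \<longrightarrow> Q \<subseteq> N"
        by (rule nested_set_representative[OF bs \<N> K(1)])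
      obtain b where "b \<in> N" "c b \<le> c e"
        using K(3) Q(3) by blast
      then have "\<not> N \<subset> Q"
        using less[OF Q(4) N, of b] by fastforce
      then show "K = N"
        using K(2) Q(2) by blast
    qed
    then show "N \<in> ?R"
      using N \<N> by (auto simp: nested_set_def)
  next
    fix B assume B: "B \<in> ?R"
    then have "B \<in> \<B>"
      by simp
    obtain Q e where Q: "Q \<in> insert UNIV \<N>" "B \<subseteq> Q" "e \<in> B" "\<forall>N\<in>\<N>. e \<in> N \<longrightarrow> Q \<subseteq> N"
      by (rule nested_set_representative[OF bs \<N> \<open>B \<in> \<B>\<close>])
    have "Q \<in> \<B>"
      using Q(1) \<B> \<N> by (auto simp: connected_building_set_def nested_set_def)
    \<comment> \<open>The representative \<open>e\<close> lies in \<open>B\<close> and attains the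
      minimum of \<open>c\<close> over all of \<open>Q\<close>, so \<open>Q\<close> competes with
      \<open>B\<close> for maximality.\<close>
    moreover have "\<forall>s\<in>Q. \<exists>b\<in>B. c b \<le> c s"
      using Q(3) le[OF Q(4)] by blast
    ultimately have "Q = B"
      using B Q(2) by simp
    then show "B \<in> \<N>"
      using B Q(1) by auto
  }
qed

section \<open>Tight sets\<close>

text \<open>\<open>UNIV\<close> is left out: its equation holds at every point of the removahedron,
  and nested sets exclude it.\<close>

definition tight_sets :: "'e::finite set set \<Rightarrow> real^'e \<Rightarrow> 'e set set" where
  "tight_sets \<B> x = {B \<in> \<B> - {UNIV}. (\<Sum>s\<in>B. x $ s) = real ((card B + 1) choose 2)}"

text \<open>Coordinate sums are additive over union and intersection, so two crossing tight sets
  would violate the inequality of their union or intersection. For (N2), the coordinate sum over a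
  union of disjoint tight sets falls strictly below the bound for that union.\<close>

lemma nested_tight_sets:
  fixes \<B> :: "'e::finite set set"
  assumes \<B>: "building_set \<B>" "closed_under_intersection \<B>" and x: "x \<in> removahedron \<B>"
  shows "nested_set \<B> (tight_sets \<B> x)"
  unfolding nested_set_def
proof (intro conjI ballI allI impI)
  let ?f = "\<lambda>B::'e set. real ((card B + 1) choose 2)"
  have ge: "(\<Sum>s\<in>B. x $ s) \<ge> ?f B" if "B \<in> \<B> \<union> {{}}" for B
    using x that by (auto simp: removahedron_def)
  show "tight_sets \<B> x \<subseteq> \<B> - {UNIV}"
    by (auto simp: tight_sets_def)
  fix A B assume AB: "A \<in> tight_sets \<B> x" "B \<in> tight_sets \<B> x"
  show "A \<subseteq> B \<or> B \<subseteq> A \<or> A \<inter> B = {}"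
  proof (rule ccontr)
    assume *: "\<not> ?thesis"
    then have "A \<union> B \<in> \<B>" "A \<inter> B \<in> \<B> \<union> {{}}"
      using \<B> AB by (auto simp: building_set_def closed_under_intersection_def tight_sets_def)
    then have "?f (A \<union> B) + ?f (A \<inter> B) \<le> (\<Sum>s\<in>A \<union> B. x $ s) + (\<Sum>s\<in>A \<inter> B. x $ s)"
      by (intro add_mono ge) auto
    also have "\<dots> = ?f A + ?f B"
      using AB by (simp add: sum.union_inter tight_sets_def)
    finally show False
      using choose_two_supermodular[of A B] * by simp
  qed
next
  let ?f = "\<lambda>B::'e set. real ((card B + 1) choose 2)"
  fix S assume S: "S \<subseteq> tight_sets \<B> x" "2 \<le> card S \<and> pairwise disjnt S"
  show "\<Union>S \<notin> \<B>"
  proof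
    assume "\<Union>S \<in> \<B>"
    then have "?f (\<Union>S) \<le> (\<Sum>s\<in>\<Union>S. x $ s)"
      using x by (auto simp: removahedron_def)
    also have "\<dots> = (\<Sum>N\<in>S. \<Sum>s\<in>N. x $ s)"
      using S by (intro sum.Union_disjoint[unfolded o_def]) (auto simp: pairwise_def disjnt_def)
    also have "\<dots> = (\<Sum>N\<in>S. ?f N)"
      using S by (intro sum.cong) (auto simp: tight_sets_def)
    also have "\<dots> < ?f (\<Union>S)"
      using S \<B> by (intro choose_two_sum_disjoint_strict) (auto simp: tight_sets_def building_set_def)
    finally show False
      by simp
  qed
qed

text \<open>Finitely many strict inequalities survive a small step by continuity. A tight one
  changes by \<open>\<epsilon>\<close> times the coordinate sum of \<open>d\<close>, and the total
  is fixed because \<open>d\<close> has sum zero.\<close>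

lemma removahedron_perturb:
  fixes \<B> :: "'e::finite set set"
  assumes x: "x \<in> removahedron \<B>" and d: "d \<in> sum_zero_space"
    and nonneg: "\<And>B. B \<in> tight_sets \<B> x \<Longrightarrow> (\<Sum>s\<in>B. d $ s) \<ge> 0"
  obtains \<epsilon> where "\<epsilon> > 0" "x + \<epsilon> *\<^sub>R d \<in> removahedron \<B>"
    "tight_sets \<B> (x + \<epsilon> *\<^sub>R d) = {B \<in> tight_sets \<B> x. (\<Sum>s\<in>B. d $ s) = 0}"
proof -
  let ?f = "\<lambda>B::'e set. real ((card B + 1) choose 2)"
  let ?L = "\<B> - insert UNIV (tight_sets \<B> x)"
  have "eventually (\<lambda>\<epsilon>. (\<Sum>s\<in>B. x $ s) + \<epsilon> * (\<Sum>s\<in>B. d $ s) > ?f B) (at_right 0)"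
    if "B \<in> ?L" for B
  proof (rule order_tendstoD)
    show "((\<lambda>\<epsilon>. (\<Sum>s\<in>B. x $ s) + \<epsilon> * (\<Sum>s\<in>B. d $ s)) \<longlongrightarrow>
        (\<Sum>s\<in>B. x $ s) + 0 * (\<Sum>s\<in>B. d $ s)) (at_right 0)"
      by (intro tendsto_intros)
    show "?f B < (\<Sum>s\<in>B. x $ s) + 0 * (\<Sum>s\<in>B. d $ s)"
      using x that by (force simp: removahedron_def tight_sets_def)
  qed
  then have "eventually (\<lambda>\<epsilon>. \<forall>B\<in>?L. (\<Sum>s\<in>B. x $ s) + \<epsilon> * (\<Sum>s\<in>B. d $ s) > ?f B) (at_right 0)"
    by (intro eventually_ball_finite) auto
  moreover have "eventually (\<lambda>\<epsilon>::real. \<epsilon> > 0) (at_right 0)"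
    by (rule eventually_at_right_less)
  ultimately have "eventually (\<lambda>\<epsilon>. \<epsilon> > 0 \<and>
      (\<forall>B\<in>?L. (\<Sum>s\<in>B. x $ s) + \<epsilon> * (\<Sum>s\<in>B. d $ s) > ?f B)) (at_right 0)"
    by eventually_elim simp
  then obtain \<epsilon> where \<epsilon>: "\<epsilon> > 0"
    and L: "\<And>B. B \<in> ?L \<Longrightarrow> (\<Sum>s\<in>B. x $ s) + \<epsilon> * (\<Sum>s\<in>B. d $ s) > ?f B"
    using eventually_happens'[OF trivial_limit_at_right_real] by blast
  have sum: "(\<Sum>s\<in>B. (x + \<epsilon> *\<^sub>R d) $ s) = (\<Sum>s\<in>B. x $ s) + \<epsilon> * (\<Sum>s\<in>B. d $ s)" for B
    by (simp add: sum.distrib sum_distrib_left)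
  have U: "(\<Sum>s\<in>UNIV. (x + \<epsilon> *\<^sub>R d) $ s) = ?f UNIV"
    unfolding sum using x d by (simp add: removahedron_def sum_zero_space_def)
  have T: "(\<Sum>s\<in>B. x $ s) = ?f B" if "B \<in> tight_sets \<B> x" for B
    using that by (simp add: tight_sets_def)
  have ge: "(\<Sum>s\<in>B. (x + \<epsilon> *\<^sub>R d) $ s) \<ge> ?f B" if B: "B \<in> \<B>" for B
  proof -
    consider "B = UNIV" | "B \<in> tight_sets \<B> x" | "B \<in> ?L"
      using B by blast
    then show ?thesis
    proof cases
      case 1
      then show ?thesis
        using U by simp
    next
      case 2
      then show ?thesis
        unfolding sum using nonneg[of B] \<epsilon> T[of B] by simp
    next
      case 3
      then show ?thesis
        unfolding sum using L[of B] by simp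
    qed
  qed
  show thesis
  proof (rule that[OF \<epsilon>])
    show "x + \<epsilon> *\<^sub>R d \<in> removahedron \<B>"
      using U ge by (simp add: removahedron_def)
    have "B \<in> tight_sets \<B> (x + \<epsilon> *\<^sub>R d) \<longleftrightarrow> B \<in> tight_sets \<B> x \<and> (\<Sum>s\<in>B. d $ s) = 0" for B
    proof (cases "B \<in> ?L")
      case True
      then show ?thesis
        using L[of B] by (auto simp: tight_sets_def sum simp del: vector_add_component)
    next
      case False
      then show ?thesis
        using \<epsilon> T[of B] by (auto simp: tight_sets_def sum simp del: vector_add_component)
    qed
    then show "tight_sets \<B> (x + \<epsilon> *\<^sub>R d) = {B \<in> tight_sets \<B> x. (\<Sum>s\<in>B. d $ s) = 0}"
      by blast
  qed
qed

section \<open>The geometry of the removahedron\<close>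

lemma removahedron_eq_inner:
  fixes \<B> :: "'e::finite set set"
  shows "removahedron \<B> =
    {x. indicator_vec UNIV \<bullet> x = real ((CARD('e) + 1) choose 2)} \<inter>
    (\<Inter>B\<in>\<B>. {x. indicator_vec B \<bullet> x \<ge> real ((card B + 1) choose 2)})"
  by (auto simp: removahedron_def inner_indicator_vec)

lemma polyhedron_removahedron: "polyhedron (removahedron \<B>)"
  unfolding removahedron_eq_inner
  by (intro polyhedron_Int polyhedron_Inter polyhedron_hyperplane)
    (auto intro: polyhedron_halfspace_ge)

lemma convex_removahedron: "convex (removahedron \<B>)"
  by (rule polyhedron_imp_convex[OF polyhedron_removahedron])

text \<open>The singleton inequalities make all coordinates non-negative; the fixed total then
  bounds each from above.\<close>

lemma bounded_removahedron:
  fixes \<B> :: "'e::finite set set"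
  assumes "building_set \<B>"
  shows "bounded (removahedron \<B>)"
proof (rule bounded_subset[OF bounded_cbox])
  show "removahedron \<B> \<subseteq> cbox 0 (\<chi> s. real ((CARD('e) + 1) choose 2))"
  proof
    fix x assume x: "x \<in> removahedron \<B>"
    have "0 \<le> x $ s" for s
    proof -
      have "{s} \<in> \<B>"
        using assms by (simp add: building_set_def)
      then have "real ((card {s} + 1) choose 2) \<le> (\<Sum>t\<in>{s}. x $ t)"
        using x unfolding removahedron_def by blast
      then show ?thesis
        by simp
    qed
    moreover have "x $ s \<le> real ((CARD('e) + 1) choose 2)" for s
    proof -
      have "x $ s \<le> (\<Sum>t\<in>UNIV. x $ t)"
        using \<open>\<And>s. 0 \<le> x $ s\<close> by (intro member_le_sum) auto
      then show ?thesis
        using x by (simp add: removahedron_def)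
    qed
    ultimately show "x \<in> cbox 0 (\<chi> s. real ((CARD('e) + 1) choose 2))"
      by (simp add: mem_box_cart)
  qed
qed

lemma polytope_removahedron: "building_set \<B> \<Longrightarrow> polytope (removahedron \<B>)"
  by (simp add: polytope_eq_bounded_polyhedron polyhedron_removahedron bounded_removahedron)

text \<open>At the constant vector, a set of size \<open>b\<close> has sum
  \<open>b * (n + 1) / 2\<close> with \<open>n = CARD('e)\<close>, above the bound
  \<open>b * (b + 1) / 2\<close> whenever \<open>0 < b < n\<close>.\<close>

lemma removahedron_point_without_tight_sets:
  fixes \<B> :: "'e::finite set set"
  assumes "building_set \<B>"
  obtains x where "x \<in> removahedron \<B>" "tight_sets \<B> x = {}"
proof -
  define x :: "real^'e" where "x = (\<chi> s. (real CARD('e) + 1) / 2)"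
  have sum: "(\<Sum>s\<in>B. x $ s) = real (card B) * (real CARD('e) + 1) / 2" for B
    by (simp add: x_def)
  have le: "real (Suc (card B) choose 2) \<le> (\<Sum>s\<in>B. x $ s)" for B :: "'e set"
    unfolding real_Suc_choose_two sum
    by (intro divide_right_mono mult_left_mono) (auto intro: card_mono)
  have "x \<in> removahedron \<B>"
    using le by (simp add: removahedron_def real_Suc_choose_two sum)
  have "B \<notin> tight_sets \<B> x" for B
  proof
    assume B: "B \<in> tight_sets \<B> x"
    then have "B \<noteq> {}" "B \<subset> UNIV"
      using assms(1) by (auto simp: tight_sets_def building_set_def)
    then have "0 < card B" "card B < CARD('e)"
      by (auto simp: card_gt_0_iff intro: psubset_card_mono)
    then show False
      using B by (simp add: tight_sets_def sum real_Suc_choose_two del: of_nat_Suc)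
  qed
  then have "tight_sets \<B> x = {}"
    by blast
  with \<open>x \<in> removahedron \<B>\<close> show thesis
    by (rule that)
qed

section \<open>Generators of the nested fan, normal cones and faces\<close>

definition proj_indicator :: "'e::finite set \<Rightarrow> real^'e" where
  "proj_indicator R = orthogonal_proj sum_zero_space (indicator_vec R)"

lemma proj_indicator_in_sum_zero_space: "proj_indicator R \<in> sum_zero_space"
  by (simp add: proj_indicator_def orthogonal_proj_in_sum_zero_space)

lemma inner_proj_indicator_diff:
  assumes "x \<in> removahedron \<B>" "y \<in> removahedron \<B>"
  shows "proj_indicator R \<bullet> y - proj_indicator R \<bullet> x = (\<Sum>s\<in>R. y $ s) - (\<Sum>s\<in>R. x $ s)"
proof -
  have "y - x \<in> sum_zero_space"
    using assms by (simp add: removahedron_def sum_zero_space_def sum_subtractf)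
  then have "proj_indicator R \<bullet> (y - x) = indicator_vec R \<bullet> (y - x)"
    by (simp add: proj_indicator_def inner_orthogonal_proj_sum_zero_space
        orthogonal_proj_id_sum_zero_space)
  then show ?thesis
    by (simp add: inner_diff_right inner_indicator_vec)
qed

lemma convex_cone_normal_cone: "convex_cone (normal_cone P F)"
  unfolding convex_cone_iff normal_cone_def
  by (auto simp: subspace_0 subspace_add subspace_mul subspace_sum_zero_space inner_add_left
      intro: add_mono mult_left_mono)

text \<open>Farkas' lemma: a vector outside the cone of the tight sets would be decreased along a direction
  that stays inside the removahedron.\<close>

lemma normal_cone_point_subset:
  fixes \<B> :: "'e::finite set set"
  assumes x: "x \<in> removahedron \<B>" "x \<in> F"
  shows "normal_cone (removahedron \<B>) F \<subseteq> convex_cone hull (proj_indicator ` tight_sets \<B> x)"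
proof
  fix c assume c: "c \<in> normal_cone (removahedron \<B>) F"
  let ?C = "convex_cone hull (proj_indicator ` tight_sets \<B> x)"
  show "c \<in> ?C"
  proof (rule ccontr)
    assume "c \<notin> ?C"
    moreover have "convex ?C" "closed ?C"
      by (auto intro: convex_convex_cone_hull closed_convex_cone_hull)
    ultimately obtain a b where ab: "a \<bullet> c < b" "\<And>y. y \<in> ?C \<Longrightarrow> a \<bullet> y > b"
      using separating_hyperplane_closed_point[of ?C c] by blast
    have "b < 0"
      using ab(2)[OF convex_cone_hull_contains_0] by simp
    \<comment> \<open>If \<open>a\<close> were negative on some \<open>y\<close> of the cone, a
      non-negative multiple of \<open>y\<close> would have inner product exactly \<open>b\<close>,
      against strict separation.\<close>
    have nonneg: "a \<bullet> y \<ge> 0" if "y \<in> ?C" for y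
    proof (rule ccontr)
      assume "\<not> a \<bullet> y \<ge> 0"
      then have "b / (a \<bullet> y) \<ge> 0" "a \<bullet> y \<noteq> 0"
        using \<open>b < 0\<close> by (auto simp: divide_nonpos_neg)
      then have "a \<bullet> ((b / (a \<bullet> y)) *\<^sub>R y) > b"
        using that by (intro ab(2) convex_cone_hull_mul)
      then show False
        using \<open>a \<bullet> y \<noteq> 0\<close> by simp
    qed
    \<comment> \<open>Projecting keeps the coordinate total fixed, and it changes no inner product
      with \<open>c\<close> or the generators, which lie in \<open>sum_zero_space\<close>.\<close>
    define d where "d = orthogonal_proj sum_zero_space a"
    have "(\<Sum>s\<in>B. d $ s) \<ge> 0" if "B \<in> tight_sets \<B> x" for B
    proof -
      have "(\<Sum>s\<in>B. d $ s) = a \<bullet> proj_indicator B"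
        unfolding d_def proj_indicator_def inner_indicator_vec'[symmetric]
        by (rule inner_orthogonal_proj_sum_zero_space)
      then show ?thesis
        using nonneg[of "proj_indicator B"] that by (simp add: hull_inc)
    qed
    moreover have "d \<in> sum_zero_space"
      by (simp add: d_def orthogonal_proj_in_sum_zero_space)
    ultimately obtain \<epsilon> where \<epsilon>: "\<epsilon> > 0" "x + \<epsilon> *\<^sub>R d \<in> removahedron \<B>"
      using removahedron_perturb[OF x(1), of d] by metis
    have "d \<bullet> c = a \<bullet> c"
      using c by (simp add: d_def inner_orthogonal_proj_sum_zero_space normal_cone_def
          orthogonal_proj_id_sum_zero_space)
    then have "c \<bullet> d < 0"
      using ab(1) \<open>b < 0\<close> by (simp add: inner_commute)
    then have "\<epsilon> * (c \<bullet> d) < 0"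
      using \<epsilon> by (simp add: mult_pos_neg)
    moreover have "c \<bullet> x \<le> c \<bullet> (x + \<epsilon> *\<^sub>R d)"
      using c \<epsilon> x(2) by (auto simp: normal_cone_def)
    ultimately show False
      by (simp add: inner_add_right)
  qed
qed

text \<open>Here \<open>x\<close> is a generic point of \<open>F\<close>: its tight sets are tight
  on all of \<open>F\<close>, so their projected indicators are minimised throughout
  \<open>F\<close>.\<close>

lemma normal_cone_removahedron:
  fixes \<B> :: "'e::finite set set"
  assumes F: "x \<in> F" "F \<subseteq> removahedron \<B>" "\<And>y. y \<in> F \<Longrightarrow> tight_sets \<B> x \<subseteq> tight_sets \<B> y"
  shows "normal_cone (removahedron \<B>) F = convex_cone hull (proj_indicator ` tight_sets \<B> x)"
proof
  show "normal_cone (removahedron \<B>) F \<subseteq> convex_cone hull (proj_indicator ` tight_sets \<B> x)"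
    using F by (intro normal_cone_point_subset) auto
  have "proj_indicator B \<in> normal_cone (removahedron \<B>) F" if B: "B \<in> tight_sets \<B> x" for B
    unfolding normal_cone_def
  proof (intro CollectI conjI ballI proj_indicator_in_sum_zero_space)
    fix y z assume y: "y \<in> F" and z: "z \<in> removahedron \<B>"
    have "B \<in> tight_sets \<B> y"
      using F(3)[OF y] B by blast
    then have "(\<Sum>s\<in>B. y $ s) \<le> (\<Sum>s\<in>B. z $ s)"
      using z by (auto simp: tight_sets_def removahedron_def)
    then show "proj_indicator B \<bullet> y \<le> proj_indicator B \<bullet> z"
      using inner_proj_indicator_diff[of y \<B> z B] y z F(2) by auto
  qed
  then show "convex_cone hull (proj_indicator ` tight_sets \<B> x) \<subseteq> normal_cone (removahedron \<B>) F"
    by (intro hull_minimal convex_cone_normal_cone) auto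
qed

text \<open>Adding the inequalities of \<open>\<N>\<close> gives one supporting half-space; equality
  in the sum forces equality in each summand.\<close>

lemma face_of_removahedron_tight:
  assumes "\<N> \<subseteq> \<B>"
  shows "{y \<in> removahedron \<B>. \<forall>N\<in>\<N>. (\<Sum>s\<in>N. y $ s) = real ((card N + 1) choose 2)}
    face_of removahedron \<B>"
proof -
  let ?f = "\<lambda>N::'a set. real ((card N + 1) choose 2)"
  have inner: "(\<Sum>N\<in>\<N>. indicator_vec N) \<bullet> y = (\<Sum>N\<in>\<N>. \<Sum>s\<in>N. y $ s)" for y
    by (simp add: inner_sum_left inner_indicator_vec)
  have le: "?f N \<le> (\<Sum>s\<in>N. y $ s)" if "y \<in> removahedron \<B>" "N \<in> \<N>" for y N
    using assms that by (auto simp: removahedron_def)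
  have "(removahedron \<B> \<inter> {y. (\<Sum>N\<in>\<N>. indicator_vec N) \<bullet> y = (\<Sum>N\<in>\<N>. ?f N)})
      face_of removahedron \<B>"
    by (intro face_of_Int_supporting_hyperplane_ge convex_removahedron)
      (unfold inner, intro sum_mono le)
  moreover have "(\<Sum>s\<in>N. y $ s) = ?f N"
    if "y \<in> removahedron \<B>" "(\<Sum>N\<in>\<N>. \<Sum>s\<in>N. y $ s) = (\<Sum>N\<in>\<N>. ?f N)" "N \<in> \<N>" for y N
    using sum_mono_inv[of ?f \<N> "\<lambda>N. \<Sum>s\<in>N. y $ s" N] that le by simp
  then have "removahedron \<B> \<inter> {y. (\<Sum>N\<in>\<N>. indicator_vec N) \<bullet> y = (\<Sum>N\<in>\<N>. ?f N)} =
      {y \<in> removahedron \<B>. \<forall>N\<in>\<N>. (\<Sum>s\<in>N. y $ s) = ?f N}"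
    unfolding inner by (auto intro!: sum.cong)
  ultimately show ?thesis
    by simp
qed

text \<open>Tightness of \<open>B\<close> cuts out a face of the removahedron, and a face meeting
  the relative interior of \<open>F\<close> contains \<open>F\<close>.\<close>

lemma rel_interior_face_tight_sets:
  assumes F: "F face_of removahedron \<B>" and x: "x \<in> rel_interior F" and y: "y \<in> F"
  shows "tight_sets \<B> x \<subseteq> tight_sets \<B> y"
proof
  fix B assume B: "B \<in> tight_sets \<B> x"
  let ?G = "{y \<in> removahedron \<B>. \<forall>N\<in>{B}. (\<Sum>s\<in>N. y $ s) = real ((card N + 1) choose 2)}"
  have "F \<subseteq> removahedron \<B>"
    using F by (rule face_of_imp_subset)
  moreover from this have "x \<in> ?G"
    using B x rel_interior_subset by (auto simp: tight_sets_def)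
  moreover have "?G face_of removahedron \<B>"
    using B by (intro face_of_removahedron_tight) (auto simp: tight_sets_def)
  ultimately have "F \<subseteq> ?G"
    using x by (intro subset_of_face_of[of ?G "removahedron \<B>"]) auto
  then show "B \<in> tight_sets \<B> y"
    using y B by (auto simp: tight_sets_def)
qed

text \<open>Provides a generic point for every nested set, from which both the missing half of the
  fan equality and the witnesses separating facets are obtained.\<close>

lemma nested_set_eq_tight_sets:
  fixes \<B> :: "'e::finite set set"
  assumes \<B>: "connected_building_set \<B>" "closed_under_intersection \<B>" and \<N>: "nested_set \<B> \<N>"
  obtains x where "x \<in> removahedron \<B>" "tight_sets \<B> x = \<N>"
proof -
  have bs: "building_set \<B>"
    using \<B> by (simp add: connected_building_set_def)
  \<comment> \<open>Weight 1 on every generator places \<open>c\<close> in the relative interior of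
    the cone of \<open>\<N>\<close>.\<close>
  define c :: "real^'e" where "c = (\<Sum>N\<in>\<N>. proj_indicator N)"
  have "removahedron \<B> \<noteq> {}"
    by (rule removahedron_point_without_tight_sets[OF bs]) blast
  then have "\<exists>x\<in>removahedron \<B>. \<forall>y\<in>removahedron \<B>. c \<bullet> x \<le> c \<bullet> y"
    using polytope_imp_compact[OF polytope_removahedron[OF bs]]
    by (intro continuous_attains_inf continuous_intros) auto
  then obtain x where x: "x \<in> removahedron \<B>" "\<And>y. y \<in> removahedron \<B> \<Longrightarrow> c \<bullet> x \<le> c \<bullet> y"
    by blast
  let ?T = "tight_sets \<B> x"
  have T: "nested_set \<B> ?T"
    using bs \<B>(2) x(1) by (rule nested_tight_sets)
  have "c \<in> sum_zero_space"
    unfolding c_def by (intro subspace_sum subspace_sum_zero_space proj_indicator_in_sum_zero_space)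
  then have "c \<in> normal_cone (removahedron \<B>) {x}"
    using x by (simp add: normal_cone_def)
  then have "c \<in> convex_cone hull (proj_indicator ` ?T)"
    using normal_cone_point_subset[OF x(1), of "{x}"] by blast
  then obtain k where k: "\<And>B. B \<in> ?T \<Longrightarrow> k B \<ge> 0" "c = (\<Sum>B\<in>?T. k B *\<^sub>R proj_indicator B)"
    using convex_cone_hull_image_sumE[of ?T c proj_indicator] by auto
  \<comment> \<open>Dropping zero coefficients makes \<open>c\<close> a strictly positive
    combination over a nested set, so \<open>T'\<close> and \<open>\<N>\<close> are both read off
    from the superlevel sets of the same \<open>c\<close>.\<close>
  define T' where "T' = {B \<in> ?T. k B > 0}"
  have proj_nth: "proj_indicator N $ s = (if s \<in> N then 1 else 0) - real (card N) / CARD('e)"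
    for N :: "'e set" and s
    by (simp add: proj_indicator_def orthogonal_proj_sum_zero_space indicator_vec_nth sum.If_cases)
  \<comment> \<open>Projection shifts all coordinates by a common amount, which becomes the constant
    \<open>a\<close> of \<open>nested_set_eq_superlevel\<close>.\<close>
  have "c $ s = - (\<Sum>N\<in>\<N>. real (card N) / CARD('e)) + (\<Sum>N\<in>\<N>. if s \<in> N then 1 else 0)" for s
    by (simp add: c_def proj_nth sum_subtractf)
  then have "\<N> = {B \<in> \<B> - {UNIV}. \<forall>K\<in>\<B>. B \<subseteq> K \<and> (\<forall>e\<in>K. \<exists>b\<in>B. c $ b \<le> c $ e) \<longrightarrow> K = B}"
    by (intro nested_set_eq_superlevel[OF \<B>(1) \<N>, of "\<lambda>_. 1"]) simp_all
  also have "T' = \<dots>"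
  proof (rule nested_set_eq_superlevel[OF \<B>(1), where c = "($) c"])
    show "nested_set \<B> T'"
      by (rule nested_set_subset[OF T]) (auto simp: T'_def)
    have c: "c = (\<Sum>B\<in>T'. k B *\<^sub>R proj_indicator B)"
      unfolding k(2) T'_def using k(1) by (intro sum.mono_neutral_right) force+
    show "c $ s = - (\<Sum>B\<in>T'. k B * (real (card B) / CARD('e))) + (\<Sum>B\<in>T'. if s \<in> B then k B else 0)"
      for s
    proof -
      have "c $ s = (\<Sum>B\<in>T'. (if s \<in> B then k B else 0) - k B * (real (card B) / CARD('e)))"
        unfolding c sum_component by (intro sum.cong) (auto simp: proj_nth right_diff_distrib)
      then show ?thesis
        by (simp add: sum_subtractf)
    qed
  qed (simp add: T'_def)
  finally have "\<N> \<subseteq> ?T"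
    by (auto simp: T'_def)
  \<comment> \<open>Value 0 keeps \<open>\<N>\<close> tight and, at \<open>UNIV\<close>, the total
    fixed; value 1 loosens every other tight set.\<close>
  obtain d :: "real^'e" where
    d: "\<forall>N\<in>insert UNIV ?T. (\<Sum>s\<in>N. d $ s) = (if N \<in> insert UNIV \<N> then 0 else 1)"
    by (rule nested_set_interpolation[OF \<B>(1) T])
  have "d \<in> sum_zero_space"
    using d by (simp add: sum_zero_space_def)
  moreover have "\<And>B. B \<in> ?T \<Longrightarrow> (\<Sum>s\<in>B. d $ s) \<ge> 0"
    using d by simp
  ultimately obtain \<epsilon> where "x + \<epsilon> *\<^sub>R d \<in> removahedron \<B>"
    "tight_sets \<B> (x + \<epsilon> *\<^sub>R d) = {B \<in> ?T. (\<Sum>s\<in>B. d $ s) = 0}"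
    by (rule removahedron_perturb[OF x(1)])
  moreover have "{B \<in> ?T. (\<Sum>s\<in>B. d $ s) = 0} = \<N>"
    using d \<open>\<N> \<subseteq> ?T\<close> by (auto simp: tight_sets_def split: if_splits)
  ultimately show thesis
    using that by simp
qed

lemma normal_fan_removahedron:
  fixes \<B> :: "'e::finite set set"
  assumes \<B>: "connected_building_set \<B>" "closed_under_intersection \<B>"
  shows "normal_fan (removahedron \<B>) = nested_fan \<B>"
proof -
  have bs: "building_set \<B>"
    using \<B> by (simp add: connected_building_set_def)
  have fan: "nested_fan \<B> = {convex_cone hull (proj_indicator ` \<N>) | \<N>. nested_set \<B> \<N>}"
    by (simp add: nested_fan_def proj_indicator_def)
  show ?thesis
  proof (intro subset_antisym subsetI)
    fix C assume "C \<in> normal_fan (removahedron \<B>)"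
    then obtain F where F: "F face_of removahedron \<B>" "F \<noteq> {}" and C: "C = normal_cone (removahedron \<B>) F"
      by (auto simp: normal_fan_def)
    then obtain x where x: "x \<in> rel_interior F"
      using rel_interior_eq_empty[OF face_of_imp_convex[OF F(1)]] by blast
    then have xF: "x \<in> F" "F \<subseteq> removahedron \<B>"
      using rel_interior_subset face_of_imp_subset[OF F(1)] by auto
    then have "C = convex_cone hull (proj_indicator ` tight_sets \<B> x)"
      unfolding C using rel_interior_face_tight_sets[OF F(1) x] by (intro normal_cone_removahedron) auto
    then show "C \<in> nested_fan \<B>"
      unfolding fan using nested_tight_sets[OF bs \<B>(2), of x] xF by blast
  next
    fix C assume "C \<in> nested_fan \<B>"
    then obtain \<N> where \<N>: "nested_set \<B> \<N>" and C: "C = convex_cone hull (proj_indicator ` \<N>)"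
      unfolding fan by blast
    obtain x where x: "x \<in> removahedron \<B>" "tight_sets \<B> x = \<N>"
      by (rule nested_set_eq_tight_sets[OF \<B> \<N>])
    define F where "F = {y \<in> removahedron \<B>. \<forall>N\<in>\<N>. (\<Sum>s\<in>N. y $ s) = real ((card N + 1) choose 2)}"
    have "x \<in> F"
      using x by (auto simp: F_def tight_sets_def)
    moreover have "normal_cone (removahedron \<B>) F = C"
      unfolding C x(2)[symmetric] using \<open>x \<in> F\<close> \<N> x
      by (intro normal_cone_removahedron) (auto simp: F_def nested_set_def tight_sets_def)
    moreover have "F face_of removahedron \<B>"
      unfolding F_def using \<N> by (intro face_of_removahedron_tight) (auto simp: nested_set_def)
    ultimately show "C \<in> normal_fan (removahedron \<B>)"
      by (auto simp: normal_fan_def)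
  qed
qed

section \<open>Simplicity\<close>

text \<open>The strict inequalities of the proper members cut a non-empty relatively open piece out
  of the hyperplane \<open>H\<close>. The removahedron lies between this piece and \<open>H\<close>,
  and both have the same affine hull.\<close>

lemma aff_dim_removahedron:
  fixes \<B> :: "'e::finite set set"
  assumes bs: "building_set \<B>"
  shows "aff_dim (removahedron \<B>) = int CARD('e) - 1"
proof -
  let ?f = "\<lambda>B::'e set. real ((card B + 1) choose 2)"
  define H where "H = {x::real^'e. indicator_vec UNIV \<bullet> x = ?f UNIV}"
  define T where "T = (\<Inter>B\<in>\<B> - {UNIV}. {x::real^'e. indicator_vec B \<bullet> x > ?f B})"
  have "(indicator_vec UNIV :: real^'e) \<noteq> 0"
    by (auto simp: vec_eq_iff indicator_vec_nth)
  then have H: "aff_dim H = int CARD('e) - 1"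
    by (simp add: H_def)
  have "affine H"
    unfolding H_def by (rule affine_hyperplane)
  moreover have "open T"
    unfolding T_def by (intro open_INT) (auto intro: open_halfspace_gt)
  moreover have "H \<inter> T \<noteq> {}"
  proof -
    obtain x where x: "x \<in> removahedron \<B>" "tight_sets \<B> x = {}"
      by (rule removahedron_point_without_tight_sets[OF bs])
    have "?f B < indicator_vec B \<bullet> x" if "B \<in> \<B> - {UNIV}" for B
    proof -
      have "B \<notin> tight_sets \<B> x"
        using x by simp
      then have "indicator_vec B \<bullet> x \<noteq> ?f B"
        using that by (simp add: tight_sets_def inner_indicator_vec)
      moreover have "?f B \<le> indicator_vec B \<bullet> x"
        using x that by (simp add: removahedron_def inner_indicator_vec)
      ultimately show ?thesis
        by simp
    qed
    then have "x \<in> H \<inter> T"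
      using x by (simp add: H_def T_def removahedron_def inner_indicator_vec)
    then show ?thesis
      by (rule ex_in_conv[THEN iffD1, OF exI])
  qed
  ultimately have "affine hull (H \<inter> T) = affine hull H"
    by (rule affine_hull_affine_Int_open)
  then have "aff_dim (H \<inter> T) = int CARD('e) - 1"
    using H by (metis aff_dim_affine_hull)
  moreover have "H \<inter> T \<subseteq> removahedron \<B>"
  proof
    fix x assume x: "x \<in> H \<inter> T"
    have "?f B \<le> indicator_vec B \<bullet> x" if "B \<in> \<B>" for B
    proof (cases "B = UNIV")
      case True
      then show ?thesis
        using x by (simp add: H_def)
    next
      case False
      then have "?f B < indicator_vec B \<bullet> x"
        using x that by (simp add: T_def)
      then show ?thesis
        by simp
    qed
    then show "x \<in> removahedron \<B>"
      using x by (simp add: H_def removahedron_eq_inner)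
  qed
  moreover have "removahedron \<B> \<subseteq> H"
    by (auto simp: H_def removahedron_eq_inner)
  ultimately show ?thesis
    using H aff_dim_subset by (metis order_antisym)
qed

lemma mem_open_segment_opposite:
  fixes v d :: "'a::real_vector"
  assumes "a > 0" "b > 0" "d \<noteq> 0"
  shows "v \<in> open_segment (v + a *\<^sub>R d) (v + b *\<^sub>R - d)"
proof -
  \<comment> \<open>The weight that balances the two opposite displacements:
    \<open>(1 - u) * a = u * b\<close>.\<close>
  define u where "u = a / (a + b)"
  have "u * b = a - u * a"
    using assms by (simp add: u_def field_simps)
  then have "v = (1 - u) *\<^sub>R (v + a *\<^sub>R d) + u *\<^sub>R (v + b *\<^sub>R - d)"
    by (simp add: scaleR_add_right scaleR_diff_left scaleR_diff_right left_diff_distrib)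
  moreover have "0 < u" "u < 1"
    using assms by (auto simp: u_def)
  moreover have "v + a *\<^sub>R d \<noteq> v + b *\<^sub>R - d"
  proof
    assume "v + a *\<^sub>R d = v + b *\<^sub>R - d"
    then have "(a + b) *\<^sub>R d = 0"
      by (simp add: scaleR_add_left)
    then show False
      using assms by simp
  qed
  ultimately show ?thesis
    unfolding in_segment by blast
qed

text \<open>With nothing tight at \<open>x\<close>, the segment from any \<open>y\<close> to
  \<open>x\<close> extends beyond \<open>x\<close> inside the removahedron, so the face property
  forces \<open>y\<close> into \<open>F\<close>.\<close>

lemma face_of_removahedron_eqI:
  assumes F: "F face_of removahedron \<B>" and x: "x \<in> F" "tight_sets \<B> x = {}"
  shows "F = removahedron \<B>"
proof
  show "removahedron \<B> \<subseteq> F"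
  proof
    fix y assume y: "y \<in> removahedron \<B>"
    have xP: "x \<in> removahedron \<B>"
      using F x face_of_imp_subset by blast
    then have "x - y \<in> sum_zero_space"
      using y by (simp add: removahedron_def sum_zero_space_def sum_subtractf)
    then obtain \<epsilon> where \<epsilon>: "\<epsilon> > 0" "x + \<epsilon> *\<^sub>R (x - y) \<in> removahedron \<B>"
      using removahedron_perturb[OF xP, of "x - y"] x(2) by (metis empty_iff)
    show "y \<in> F"
    proof (cases "x = y")
      case False
      then have "x \<in> open_segment (x + \<epsilon> *\<^sub>R (x - y)) (x + 1 *\<^sub>R - (x - y))"
        using \<epsilon> by (intro mem_open_segment_opposite) auto
      then have "x \<in> open_segment (x + \<epsilon> *\<^sub>R (x - y)) y"
        by simp
      then show ?thesis
        using F x y \<epsilon> unfolding face_of_def by blast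
    qed (use x in simp)
  qed
qed (use F face_of_imp_subset in auto)

section \<open>Facets and vertices\<close>

definition removahedron_facet :: "'e::finite set set \<Rightarrow> 'e set \<Rightarrow> (real^'e) set" where
  "removahedron_facet \<B> B =
    {y \<in> removahedron \<B>. (\<Sum>s\<in>B. y $ s) = real ((card B + 1) choose 2)}"

lemma removahedron_facet_face_of: "B \<in> \<B> \<Longrightarrow> removahedron_facet \<B> B face_of removahedron \<B>"
  using face_of_removahedron_tight[of "{B}" \<B>] by (simp add: removahedron_facet_def)

lemma removahedron_facet_witness:
  fixes \<B> :: "'e::finite set set"
  assumes \<B>: "connected_building_set \<B>" "closed_under_intersection \<B>"
    and B: "B \<in> \<B> - {UNIV}"
  obtains x where "x \<in> removahedron_facet \<B> B" "tight_sets \<B> x = {B}"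
proof -
  have "nested_set \<B> {B}"
    unfolding nested_set_def
  proof (intro conjI allI impI)
    fix S assume "S \<subseteq> {B}" "2 \<le> card S \<and> pairwise disjnt S"
    then show "\<Union>S \<notin> \<B>"
      \<comment> \<open>A subfamily of a singleton has at most one member, so (N2) is
        vacuous.\<close>
      using card_mono[of "{B}" S] by simp
  qed (use B in auto)
  then obtain x where "x \<in> removahedron \<B>" "tight_sets \<B> x = {B}"
    by (rule nested_set_eq_tight_sets[OF \<B>])
  then show thesis
    by (intro that) (auto simp: removahedron_facet_def tight_sets_def)
qed

text \<open>A point where only \<open>B\<close> is tight lies on no other such face. Inclusion
  rather than equality is treated because a face is later compared with a facet containing
  it.\<close>

lemma removahedron_facet_subset_iff:
  fixes \<B> :: "'e::finite set set"
  assumes \<B>: "connected_building_set \<B>" "closed_under_intersection \<B>"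
    and B: "B \<in> \<B> - {UNIV}" "B' \<in> \<B> - {UNIV}"
  shows "removahedron_facet \<B> B \<subseteq> removahedron_facet \<B> B' \<longleftrightarrow> B = B'"
proof
  assume sub: "removahedron_facet \<B> B \<subseteq> removahedron_facet \<B> B'"
  obtain x where "x \<in> removahedron_facet \<B> B" "tight_sets \<B> x = {B}"
    by (rule removahedron_facet_witness[OF \<B> B(1)])
  then have "x \<in> removahedron_facet \<B> B'"
    using sub by blast
  then have "B' \<in> tight_sets \<B> x"
    using B by (simp add: removahedron_facet_def tight_sets_def)
  then show "B = B'"
    using \<open>tight_sets \<B> x = {B}\<close> by simp
qed simp

text \<open>A facet has a tight set at a relative interior point, hence lies in the proper face of
  that set, and dimensions force equality. Conversely, the face of \<open>B\<close> lies in some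
  facet, which is the face of some \<open>B'\<close>, and the inclusion gives
  \<open>B = B'\<close>.\<close>

lemma facet_of_removahedron_iff:
  fixes \<B> :: "'e::finite set set"
  assumes \<B>: "connected_building_set \<B>" "closed_under_intersection \<B>"
  shows "F facet_of removahedron \<B> \<longleftrightarrow> (\<exists>B\<in>\<B> - {UNIV}. F = removahedron_facet \<B> B)"
proof -
  have bs: "building_set \<B>"
    using \<B> by (simp add: connected_building_set_def)
  have proper: "removahedron_facet \<B> B \<noteq> removahedron \<B>" if "B \<in> \<B> - {UNIV}" for B
  proof
    obtain x where x: "x \<in> removahedron \<B>" "tight_sets \<B> x = {}"
      by (rule removahedron_point_without_tight_sets[OF bs])
    assume "removahedron_facet \<B> B = removahedron \<B>"
    then have "x \<in> removahedron_facet \<B> B"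
      using x by simp
    then have "B \<in> tight_sets \<B> x"
      using that by (simp add: removahedron_facet_def tight_sets_def)
    then show False
      using x by simp
  qed
  have facetD: "\<exists>B\<in>\<B> - {UNIV}. F = removahedron_facet \<B> B" if "F facet_of removahedron \<B>" for F
  proof -
    have F: "F face_of removahedron \<B>" "F \<noteq> {}" "aff_dim F = aff_dim (removahedron \<B>) - 1"
      using that by (auto simp: facet_of_def)
    then obtain x where x: "x \<in> rel_interior F"
      using rel_interior_eq_empty[OF face_of_imp_convex[OF F(1)]] by blast
    have "F \<noteq> removahedron \<B>"
      using that by auto
    then obtain B where B: "B \<in> tight_sets \<B> x"
      using face_of_removahedron_eqI[OF F(1), of x] x rel_interior_subset by blast
    then have B': "B \<in> \<B> - {UNIV}"
      by (simp add: tight_sets_def)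
    have sub: "F \<subseteq> removahedron_facet \<B> B"
      using rel_interior_face_tight_sets[OF F(1) x] B face_of_imp_subset[OF F(1)]
      by (fastforce simp: removahedron_facet_def tight_sets_def)
    have G: "removahedron_facet \<B> B face_of removahedron \<B>"
      using B' by (intro removahedron_facet_face_of) simp
    then have "aff_dim (removahedron_facet \<B> B) < aff_dim (removahedron \<B>)"
      using proper[OF B'] by (intro face_of_aff_dim_lt convex_removahedron)
    moreover have "F face_of removahedron_facet \<B> B"
      using F(1) sub face_of_imp_subset[OF G] by (rule face_of_subset)
    ultimately have "F = removahedron_facet \<B> B"
      using F(3) face_of_aff_dim_lt[OF face_of_imp_convex[OF G], of F] by linarith
    then show ?thesis
      using B' by (rule bexI)
  qed
  show ?thesis
  proof
    assume "\<exists>B\<in>\<B> - {UNIV}. F = removahedron_facet \<B> B"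
    then obtain B where B: "B \<in> \<B> - {UNIV}" "F = removahedron_facet \<B> B"
      by (rule bexE)
    have "F \<noteq> {}"
      unfolding B(2) by (rule removahedron_facet_witness[OF \<B> B(1)]) blast
    moreover have "F face_of removahedron \<B>" "F \<noteq> removahedron \<B>"
      using removahedron_facet_face_of[of B \<B>] proper[OF B(1)] B by simp_all
    ultimately obtain F' where F': "F' facet_of removahedron \<B>" "F \<subseteq> F'"
      using face_of_polyhedron_subset_facet[OF polyhedron_removahedron] by metis
    obtain B' where B': "B' \<in> \<B> - {UNIV}" "F' = removahedron_facet \<B> B'"
      using facetD[OF F'(1)] by (rule bexE)
    then have "B = B'"
      using removahedron_facet_subset_iff[OF \<B> B(1) B'(1)] B(2) F'(2) by simp
    then show "F facet_of removahedron \<B>"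
      using F'(1) B(2) B'(2) by simp
  qed (rule facetD)
qed

text \<open>Independence bounds the number of tight sets from above. With too few of them, some
  non-zero \<open>d\<close> is orthogonal to all their indicators, and moving both ways along
  \<open>d\<close> contradicts extremality. The \<open>- 1\<close> accounts for
  \<open>UNIV\<close>.\<close>

lemma card_tight_sets_extreme_point:
  fixes \<B> :: "'e::finite set set"
  assumes \<B>: "connected_building_set \<B>" "closed_under_intersection \<B>"
    and v: "v extreme_point_of removahedron \<B>"
  shows "int (card (tight_sets \<B> v)) = int CARD('e) - 1"
proof -
  have bs: "building_set \<B>"
    using \<B> by (simp add: connected_building_set_def)
  have vP: "v \<in> removahedron \<B>"
    using v by (simp add: extreme_point_of_def)
  let ?T = "insert UNIV (tight_sets \<B> v)"
  let ?I = "indicator_vec ` ?T :: (real^'e) set"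
  have card: "card ?I = Suc (card (tight_sets \<B> v))"
    by (subst card_image[OF inj_on_subset[OF inj_indicator_vec subset_UNIV]])
      (simp add: tight_sets_def)
  have "independent ?I"
    using \<B>(1) nested_tight_sets[OF bs \<B>(2) vP] by (rule nested_set_independent)
  then have "card ?I \<le> CARD('e)"
    using independent_bound[of ?I] by simp
  moreover have "CARD('e) \<le> card ?I"
  proof (rule ccontr)
    assume "\<not> CARD('e) \<le> card ?I"
    then have "dim ?I < DIM(real^'e)"
      using dim_le_card'[of ?I] by simp
    then obtain d where "d \<noteq> 0" and orth: "\<And>y. y \<in> span ?I \<Longrightarrow> orthogonal d y"
      by (rule orthogonal_to_subspace_exists) blast
    have d: "(\<Sum>s\<in>N. d $ s) = 0" if "N \<in> ?T" for N
    proof -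
      have "orthogonal d (indicator_vec N)"
        using that by (intro orth span_base imageI)
      then show ?thesis
        by (simp add: orthogonal_def inner_indicator_vec')
    qed
    obtain a where a: "a > 0" "v + a *\<^sub>R d \<in> removahedron \<B>"
      by (rule removahedron_perturb[OF vP, of d]) (auto simp: d sum_zero_space_def)
    obtain b where b: "b > 0" "v + b *\<^sub>R - d \<in> removahedron \<B>"
      by (rule removahedron_perturb[OF vP, of "- d"]) (auto simp: d sum_zero_space_def sum_negf)
    have "v \<in> open_segment (v + a *\<^sub>R d) (v + b *\<^sub>R - d)"
      using a b \<open>d \<noteq> 0\<close> by (intro mem_open_segment_opposite)
    then show False
      using v a b unfolding extreme_point_of_def by blast
  qed
  ultimately show ?thesis
    using card by linarith
qed

text \<open>Facets through a vertex correspond bijectively to its tight sets, whose number equals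
  the dimension.\<close>

lemma simple_polytope_removahedron:
  fixes \<B> :: "'e::finite set set"
  assumes \<B>: "connected_building_set \<B>" "closed_under_intersection \<B>"
  shows "simple_polytope (removahedron \<B>)"
  unfolding simple_polytope_def
proof (intro conjI allI impI)
  have bs: "building_set \<B>"
    using \<B> by (simp add: connected_building_set_def)
  show "polytope (removahedron \<B>)"
    using bs by (rule polytope_removahedron)
  fix v assume v: "v extreme_point_of removahedron \<B>"
  then have "v \<in> removahedron \<B>"
    by (simp add: extreme_point_of_def)
  then have "{F. F facet_of removahedron \<B> \<and> v \<in> F} = removahedron_facet \<B> ` tight_sets \<B> v"
    unfolding facet_of_removahedron_iff[OF \<B>]
    by (auto simp: removahedron_facet_def tight_sets_def)
  moreover have "inj_on (removahedron_facet \<B>) (tight_sets \<B> v)"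
    using removahedron_facet_subset_iff[OF \<B>]
    by (intro inj_onI) (metis (mono_tags, lifting) mem_Collect_eq order_refl tight_sets_def)
  ultimately have "card {F. F facet_of removahedron \<B> \<and> v \<in> F} = card (tight_sets \<B> v)"
    by (simp add: card_image)
  then show "int (card {F. F facet_of removahedron \<B> \<and> v \<in> F}) = aff_dim (removahedron \<B>)"
    using card_tight_sets_extreme_point[OF \<B> v] by (simp add: aff_dim_removahedron[OF bs])
qed

theorem theorem2p15:
  fixes \<B> :: "'e::finite set set"
  assumes "connected_building_set \<B>"
    and "closed_under_intersection \<B>"
  shows "normal_fan (removahedron \<B>) = nested_fan \<B> \<and> simple_polytope (removahedron \<B>)"
  using normal_fan_removahedron[OF assms] simple_polytope_removahedron[OF assms] by blast

end
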